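(* Let $H(\omega_1)$ be the set of all hereditarily countable sets, and consider the graph $(H(\omega_1),\in\cup\ni)$ with vertex set $H(\omega_1)$ in which $x$ and $y$ are connected by an edge if and only if $x\in y$ or $y\in x$. This graph is prime $(\omega_1,\mathfrak{c})$-saturated.
   Context: Work in ZFC; $\mathfrak{c}=2^{\aleph_0}$. A set is hereditarily countable if it is countable, all its elements are countable, all elements of its elements are countable, and so on (i.e. its transitive closure is countable). Graphs are undirected simple graphs; $N(v)$ is the set of vertices connected to $v$. A graph $G$ is $(\lambda,\kappa)$-saturated if for any disjoint $A,B\subset G$ with $|A|<\lambda$, $|B|<\kappa$ there is a vertex $v\in G$ with $A\subseteq N(v)$ and $B\cap N(v)=\emptyset$. A $(\omega_1,\mathfrak{c})$-saturated graph is prime $(\omega_1,\mathfrak{c})$-saturated if it embeds (as an induced subgraph) into every $(\omega_1,\mathfrak{c})$-saturated graph. *)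

theory Defs
  imports "HOL-Library.Countable_Set_Type"
begin

unbundle cardinal_syntax

text \<open>
  The hereditarily countable sets form the initial algebra of the countable powerset: they are the
  well-founded extensional objects whose elements form a countable set of such objects.  The lemma
  \<open>hcset_iso_hereditarily_countable\<close> below shows that, in any well-founded extensional universe of
  sets in which every countable collection of objects is the extension of a set, the sets whose
  transitive closure is countable are isomorphic to this type.
\<close>

datatype hcset = HCSet (elems: "hcset cset")

definition hmem :: "hcset \<Rightarrow> hcset \<Rightarrow> bool" (infix \<open>in\<^sub>H\<close> 50) where
  "x in\<^sub>H y \<longleftrightarrow> cin x (elems y)"

lemma hmem_HCSet [simp]: "x in\<^sub>H HCSet X \<longleftrightarrow> x \<in> rcset X"
  by (simp add: hmem_def cin.rep_eq)

lemma hcset_ext: "(\<And>z. z in\<^sub>H x \<longleftrightarrow> z in\<^sub>H y) \<Longrightarrow> x = y"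
  by (cases x; cases y) (auto simp: rcset_inject[symmetric])

lemma hcset_countable_elems: "countable {z. z in\<^sub>H x}"
  by (cases x) simp

lemma hcset_comprehension: "countable A \<Longrightarrow> \<exists>x. \<forall>z. z in\<^sub>H x \<longleftrightarrow> z \<in> A"
  by (rule exI[of _ "HCSet (acset A)"]) simp

lemma wfp_hmem: "wfp (in\<^sub>H)"
  unfolding wfp_def wf_def
proof (intro allI impI)
  fix P x
  assume "\<forall>x. (\<forall>y. (y, x) \<in> {(x, y). x in\<^sub>H y} \<longrightarrow> P y) \<longrightarrow> P x"
  then show "P x"
    by (induction x) simp
qed

lemma hcset_iso_hereditarily_countable:
  fixes R :: "'u \<Rightarrow> 'u \<Rightarrow> bool"
  assumes wf: "wfp R"
    and ext: "\<And>x y. (\<And>z. R z x \<longleftrightarrow> R z y) \<Longrightarrow> x = y"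
    and compr: "\<And>A. countable A \<Longrightarrow> \<exists>x. \<forall>z. R z x \<longleftrightarrow> z \<in> A"
  shows "\<exists>f. bij_betw f UNIV {x. countable {y. R\<^sup>+\<^sup>+ y x}} \<and> (\<forall>a b. R (f a) (f b) \<longleftrightarrow> a in\<^sub>H b)"
proof -
  define mk where "mk A = (SOME x. \<forall>z. R z x \<longleftrightarrow> z \<in> A)" for A
  have mk: "R z (mk A) \<longleftrightarrow> z \<in> A" if "countable A" for z A
    using someI_ex[OF compr[OF that]] unfolding mk_def by blast
  define f where "f = rec_hcset (\<lambda>X. mk (rcset (cimage snd X)))"
  have f_eq: "f (HCSet X) = mk (f ` rcset X)" for X
    by (simp add: f_def cimage.rep_eq image_image cset.map_comp comp_def)
  have R_f: "R z (f x) \<longleftrightarrow> (\<exists>y. y in\<^sub>H x \<and> z = f y)" for z x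
    by (cases x) (auto simp: f_eq mk)
  have inj: "f x = f y \<Longrightarrow> x = y" for x y
  proof (induction x arbitrary: y)
    case (HCSet X)
    show ?case
    proof (rule hcset_ext)
      fix z
      have "(\<exists>a. a in\<^sub>H HCSet X \<and> w = f a) \<longleftrightarrow> (\<exists>a. a in\<^sub>H y \<and> w = f a)" for w
        using R_f[of w "HCSet X"] R_f[of w y] HCSet.prems by simp
      then show "z in\<^sub>H HCSet X \<longleftrightarrow> z in\<^sub>H y"
        using HCSet.IH by (metis hmem_HCSet)
    qed
  qed
  have tranclp_eq: "{y. R\<^sup>+\<^sup>+ y x} = {y. R y x} \<union> (\<Union>y\<in>{y. R y x}. {z. R\<^sup>+\<^sup>+ z y})" for x
    by (auto elim: tranclp.cases intro: tranclp.trancl_into_trancl)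
  have hc: "countable {y. R\<^sup>+\<^sup>+ y (f x)}" for x
  proof (induction x)
    case (HCSet X)
    have "{y. R y (f (HCSet X))} = f ` rcset X"
      by (auto simp: R_f)
    then show ?case
      using HCSet.IH by (subst tranclp_eq) auto
  qed
  have surj: "countable {y. R\<^sup>+\<^sup>+ y x} \<Longrightarrow> x \<in> range f" for x
  proof (induction x rule: wfp_induct_rule[OF wf])
    case (1 x)
    have cnt: "countable {y. R y x}"
      by (rule countable_subset[OF _ "1.prems"]) auto
    have "y \<in> range f" if "R y x" for y
      using that
      by (intro "1.IH" countable_subset[OF _ "1.prems"]) (auto intro: tranclp.trancl_into_trancl)
    then have sub: "{y. R y x} \<subseteq> range f" by auto
    define Y where "Y = inv f ` {y. R y x}"
    have fY: "f ` Y = {y. R y x}"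
      using sub by (force simp: Y_def image_image f_inv_into_f)
    have "f (HCSet (acset Y)) = x"
      using cnt fY by (intro ext) (auto simp: Y_def R_f)
    then show ?case by blast
  qed
  have "bij_betw f UNIV {x. countable {y. R\<^sup>+\<^sup>+ y x}}"
    using inj hc surj by (auto simp: bij_betw_def inj_on_def)
  moreover have "\<forall>a b. R (f a) (f b) \<longleftrightarrow> a in\<^sub>H b"
    using R_f inj by blast
  ultimately show ?thesis by blast
qed

locale simple_graph =
  fixes V :: "'a set" and E :: "'a \<Rightarrow> 'a \<Rightarrow> bool"
  assumes edge_in_V: "E x y \<Longrightarrow> x \<in> V \<and> y \<in> V"
    and edge_sym: "E x y \<Longrightarrow> E y x"
    and edge_irrefl: "\<not> E x x"

definition neighbours :: "('a \<Rightarrow> 'a \<Rightarrow> bool) \<Rightarrow> 'a \<Rightarrow> 'a set" where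
  "neighbours E v = {u. E v u}"

text \<open>Cardinal parameters are given as cardinal orders.\<close>

definition saturated_graph ::
    "'l rel \<Rightarrow> 'k rel \<Rightarrow> 'a set \<Rightarrow> ('a \<Rightarrow> 'a \<Rightarrow> bool) \<Rightarrow> bool" where
  "saturated_graph \<theta> \<kappa> V E \<longleftrightarrow> simple_graph V E \<and>
    (\<forall>A B. A \<subseteq> V \<and> B \<subseteq> V \<and> A \<inter> B = {} \<and> |A| <o \<theta> \<and> |B| <o \<kappa> \<longrightarrow>
      (\<exists>v\<in>V. A \<subseteq> neighbours E v \<and> B \<inter> neighbours E v = {}))"

definition induced_embedding ::
    "('a \<Rightarrow> 'b) \<Rightarrow> 'a set \<Rightarrow> ('a \<Rightarrow> 'a \<Rightarrow> bool) \<Rightarrow> 'b set \<Rightarrow> ('b \<Rightarrow> 'b \<Rightarrow> bool) \<Rightarrow> bool" where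
  "induced_embedding f V E V' E' \<longleftrightarrow>
    inj_on f V \<and> f ` V \<subseteq> V' \<and> (\<forall>x\<in>V. \<forall>y\<in>V. E' (f x) (f y) \<longleftrightarrow> E x y)"

text \<open>
  A definition cannot quantify over types, so the type of the vertices of the competing graphs is a
  parameter; a statement with a free type variable \<open>'b\<close> is about all saturated graphs.
\<close>

definition prime_saturated_graph ::
    "'b itself \<Rightarrow> 'l rel \<Rightarrow> 'k rel \<Rightarrow> 'a set \<Rightarrow> ('a \<Rightarrow> 'a \<Rightarrow> bool) \<Rightarrow> bool" where
  "prime_saturated_graph (_ :: 'b itself) \<theta> \<kappa> V E \<longleftrightarrow> saturated_graph \<theta> \<kappa> V E \<and>
    (\<forall>(W :: 'b set) F. saturated_graph \<theta> \<kappa> W F \<longrightarrow> (\<exists>f. induced_embedding f V E W F))"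

abbreviation omega1 :: "nat set rel" (\<open>\<omega>\<^sub>1\<close>) where
  "\<omega>\<^sub>1 \<equiv> cardSuc natLeq"

abbreviation continuum :: "(nat \<Rightarrow> bool) rel" (\<open>\<cc>\<close>) where
  "\<cc> \<equiv> ctwo ^c natLeq"

definition hedge :: "hcset \<Rightarrow> hcset \<Rightarrow> bool" where
  "hedge x y \<longleftrightarrow> x in\<^sub>H y \<or> y in\<^sub>H x"

end

theory Submission
  imports Defs "HOL-Library.Nat_Bijection"
begin

text \<open>
  Saturation: for countable \<open>A\<close>, the sets \<open>A \<union> {s}\<close> are connected to all of \<open>A\<close>, and fewer than
  continuum many choices of \<open>s\<close> make \<open>A \<union> {s}\<close> connected to some member of \<open>B\<close>.

  Primeness: the hereditarily countable sets can be well-ordered so that every set comes after its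
  elements and has fewer than continuum many predecessors.  Then the earlier neighbours of a set
  are exactly its elements, so there are only countably many, and the embedding is built by
  transfinite recursion, saturation of the target providing the image of each set.
\<close>

section \<open>Cardinal arithmetic below the continuum\<close>

lemma countable_iff_ordLess_omega1: "countable A \<longleftrightarrow> |A| <o \<omega>\<^sub>1"
  by (simp add: countable_card_le_natLeq cardSuc_ordLeq_ordLess natLeq_Card_order card_of_Card_order)

lemma continuum_eq: "\<cc> = |UNIV :: (nat \<Rightarrow> bool) set|"
  by (simp add: cexp_def ctwo_def Field_card_of Field_natLeq Func_def)

lemma countable_ordLess_continuum: "countable A \<Longrightarrow> |A| <o \<cc>"
  unfolding countable_card_le_natLeq
  by (rule ordLeq_ordLess_trans[OF _ ordLess_ctwo_cexp[OF natLeq_Card_order]])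

lemma infinite_UNIV_nat_bool: "infinite (UNIV :: (nat \<Rightarrow> bool) set)"
  using countable_ordLess_continuum[of "UNIV :: (nat \<Rightarrow> bool) set"] ordLess_irreflexive
  by (auto simp: continuum_eq dest: countable_finite)

lemma Un_ordLess_continuum: "|A| <o \<cc> \<Longrightarrow> |B| <o \<cc> \<Longrightarrow> |A \<union> B| <o \<cc>"
  unfolding continuum_eq by (rule card_of_Un_ordLess_infinite[OF infinite_UNIV_nat_bool])

text \<open>The continuum may be singular, so the argument uses countability of the pieces: an
  infinite index set absorbs them, and the union is no larger than \<open>I\<close>.\<close>

lemma UN_countable_ordLess_continuum:
  assumes I: "|I| <o \<cc>" and A: "\<And>i. i \<in> I \<Longrightarrow> countable (A i)"
  shows "|\<Union>i\<in>I. A i| <o \<cc>"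
proof (cases "finite I")
  case True
  then show ?thesis
    using A by (intro countable_ordLess_continuum countable_UN) (auto dest: countable_finite)
next
  case False
  then have "|UNIV :: nat set| \<le>o |I|"
    using infinite_iff_card_of_nat by blast
  then have "\<forall>i\<in>I. |A i| \<le>o |I|"
    using A by (meson countable_card_of_nat ordLeq_transitive)
  then have "|\<Union>i\<in>I. A i| \<le>o |I|"
    using False by (intro card_of_UNION_ordLeq_infinite card_of_mono1 subset_refl)
  then show ?thesis
    using I by (rule ordLeq_ordLess_trans)
qed

lemma image_ordLess: "|A| <o r \<Longrightarrow> |f ` A| <o r"
  by (rule ordLeq_ordLess_trans[OF card_of_image])

lemma subset_ordLess: "A \<subseteq> B \<Longrightarrow> |B| <o r \<Longrightarrow> |A| <o r"
  by (rule ordLeq_ordLess_trans[OF card_of_mono1])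

text \<open>By regularity of \<open>\<omega>\<^sub>1\<close>, the countable set \<open>K\<close> is
  not cofinal.\<close>

lemma omega1_countable_strict_bound:
  assumes K: "K \<subseteq> Field \<omega>\<^sub>1" "countable K"
  shows "\<exists>b\<in>Field \<omega>\<^sub>1. \<forall>k\<in>K. (k, b) \<in> \<omega>\<^sub>1 - Id"
proof -
  have card: "Card_order \<omega>\<^sub>1"
    by (rule cardSuc_Card_order[OF natLeq_Card_order])
  have inf: "infinite (Field \<omega>\<^sub>1)"
    using Cinfinite_cardSuc[OF natLeq_Cinfinite] by (simp add: cinfinite_def)
  have wo: "wo_rel \<omega>\<^sub>1"
    using card by (simp add: wo_rel_def card_order_on_def)
  have "regularCard \<omega>\<^sub>1"
    using natLeq_Cinfinite by (simp add: regularCard_cardSuc)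
  moreover have "\<not> |K| =o \<omega>\<^sub>1"
    using K(2) by (simp add: countable_iff_ordLess_omega1 not_ordLess_ordIso)
  ultimately have "\<not> cofinal K \<omega>\<^sub>1"
    using K(1) by (auto simp: regularCard_def)
  then obtain a where a: "a \<in> Field \<omega>\<^sub>1" "\<And>k. k \<in> K \<Longrightarrow> a = k \<or> (a, k) \<notin> \<omega>\<^sub>1"
    by (auto simp: cofinal_def)
  \<comment> \<open>The bound \<open>a\<close> may itself belong to \<open>K\<close>; a larger
    \<open>b\<close> makes the bound strict.\<close>
  obtain b where b: "b \<in> Field \<omega>\<^sub>1" "a \<noteq> b" "(a, b) \<in> \<omega>\<^sub>1"
    using infinite_Card_order_limit[OF card inf a(1)] by blast
  have "(k, b) \<in> \<omega>\<^sub>1 - Id" if "k \<in> K" for k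
  proof -
    have "(k, a) \<in> \<omega>\<^sub>1"
      using a that K(1) wo_rel.in_notinI[OF wo] wo_rel.REFL[OF wo] by (metis refl_on_def subsetD)
    then show ?thesis
      using b wo_rel.TRANS[OF wo] wo_rel.ANTISYM[OF wo] by (metis DiffI antisymD pair_in_Id_conv transD)
  qed
  then show ?thesis
    using b(1) by blast
qed

section \<open>The number of hereditarily countable sets\<close>

definition htrcl :: "hcset \<Rightarrow> hcset set" where
  "htrcl x = {z. (in\<^sub>H)\<^sup>*\<^sup>* z x}"

lemma htrcl_refl [simp]: "x \<in> htrcl x"
  by (simp add: htrcl_def)

lemma htrcl_hmem: "z in\<^sub>H y \<Longrightarrow> y \<in> htrcl x \<Longrightarrow> z \<in> htrcl x"
  by (auto simp: htrcl_def intro: converse_rtranclp_into_rtranclp)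

lemma countable_htrcl: "countable (htrcl x)"
proof (induction x)
  case (HCSet X)
  have "htrcl (HCSet X) \<subseteq> insert (HCSet X) (\<Union>y\<in>rcset X. htrcl y)"
    by (auto simp: htrcl_def elim: rtranclp.cases)
  then show ?case
    by (rule countable_subset) (auto intro: HCSet.IH)
qed

text \<open>
  Codes \<open>x\<close> by the copy on \<open>\<nat>\<close> of the membership relation on \<open>htrcl x\<close>, together with the number
  standing for \<open>x\<close>.
\<close>

definition hcode :: "hcset \<Rightarrow> nat \<Rightarrow> bool" where
  "hcode x k = (let g = to_nat_on (htrcl x) in
    case prod_decode k of
      (0, b) \<Rightarrow> b = g x
    | (Suc a, b) \<Rightarrow> \<exists>y\<in>htrcl x. \<exists>z. z in\<^sub>H y \<and> a = g z \<and> b = g y)"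

text \<open>Uniqueness in Mostowski's collapse: equal codes match \<open>htrcl x\<close> with
  \<open>htrcl x'\<close> compatibly with membership, and matched sets are equal by induction and
  extensionality.\<close>

lemma inj_hcode: "inj hcode"
proof (rule injI)
  fix x x'
  assume eq: "hcode x = hcode x'"
  define g g' where "g = to_nat_on (htrcl x)" and "g' = to_nat_on (htrcl x')"
  have g: "u = v" if "g u = g v" "u \<in> htrcl x" "v \<in> htrcl x" for u v
    using that countable_htrcl[of x] by (simp add: g_def)
  have g': "u = v" if "g' u = g' v" "u \<in> htrcl x'" "v \<in> htrcl x'" for u v
    using that countable_htrcl[of x'] by (simp add: g'_def)
  have point: "g x = g' x'"
    using fun_cong[OF eq, of "prod_encode (0, g x)"]
    by (simp add: hcode_def Let_def g_def g'_def)
  have rel: "(\<exists>y\<in>htrcl x. \<exists>z. z in\<^sub>H y \<and> a = g z \<and> b = g y) \<longleftrightarrow>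
      (\<exists>y\<in>htrcl x'. \<exists>z. z in\<^sub>H y \<and> a = g' z \<and> b = g' y)" for a b
    using fun_cong[OF eq, of "prod_encode (Suc a, b)"]
    by (simp add: hcode_def Let_def g_def g'_def)
  have "y = y'" if "y \<in> htrcl x" "y' \<in> htrcl x'" "g y = g' y'" for y y'
    using that
  proof (induction y arbitrary: y' rule: wfp_induct_rule[OF wfp_hmem])
    case (1 y)
    show ?case
    proof (rule hcset_ext)
      fix z
      show "z in\<^sub>H y \<longleftrightarrow> z in\<^sub>H y'"
      proof
        assume z: "z in\<^sub>H y"
        then obtain y'' z' where "y'' \<in> htrcl x'" "z' in\<^sub>H y''" "g z = g' z'" "g y = g' y''"
          using rel[of "g z" "g y"] "1.prems"(1) by auto
        moreover from this have "y'' = y'"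
          using g' "1.prems" by simp
        ultimately show "z in\<^sub>H y'"
          using "1.IH"[OF z] htrcl_hmem z "1.prems" by metis
      next
        assume z: "z in\<^sub>H y'"
        then obtain y'' z' where "y'' \<in> htrcl x" "z' in\<^sub>H y''" "g' z = g z'" "g' y' = g y''"
          using rel[of "g' z" "g' y'"] "1.prems"(2) by auto
        moreover from this have "y'' = y"
          using g "1.prems" by simp
        ultimately show "z in\<^sub>H y"
          using "1.IH" htrcl_hmem z "1.prems" by metis
      qed
    qed
  qed
  then show "x = x'"
    using point by simp
qed

lemma card_hcset_le_continuum: "|UNIV :: hcset set| \<le>o \<cc>"
  unfolding continuum_eq using inj_hcode by (auto intro: card_of_ordLeqI)

lemma hmem_irrefl: "\<not> x in\<^sub>H x"
  using wfp_hmem by (simp add: wfp_imp_irreflp irreflpD)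

lemma infinite_hcset: "infinite (UNIV :: hcset set)"
proof
  assume "finite (UNIV :: hcset set)"
  then obtain x where "\<forall>z. z in\<^sub>H x"
    using hcset_comprehension[of UNIV] countable_finite by auto
  then show False
    using hmem_irrefl by blast
qed

text \<open>All subsets of a countably infinite collection of sets are again sets.\<close>

lemma continuum_le_card_hcset: "\<cc> \<le>o |UNIV :: hcset set|"
proof -
  obtain c :: "nat \<Rightarrow> hcset" where c: "inj c"
    using infinite_countable_subset[OF infinite_hcset] by blast
  define h where "h p = HCSet (acset (c ` Collect p))" for p
  have "c n in\<^sub>H h p \<longleftrightarrow> p n" for n p
    using c by (auto simp: h_def inj_eq)
  then have "p = q" if "h p = h q" for p q
    using that by (intro ext) metis
  then have "inj h"
    by (rule injI)
  then show ?thesis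
    unfolding continuum_eq by (auto intro: card_of_ordLeqI)
qed

section \<open>Saturation\<close>

lemma simple_graph_hedge: "simple_graph UNIV hedge"
  by unfold_locales (auto simp: hedge_def hmem_irrefl)

lemma saturated_hedge: "saturated_graph \<omega>\<^sub>1 \<cc> (UNIV :: hcset set) hedge"
  unfolding saturated_graph_def
proof (intro conjI allI impI simple_graph_hedge)
  fix A B :: "hcset set"
  assume AB: "A \<subseteq> UNIV \<and> B \<subseteq> UNIV \<and> A \<inter> B = {} \<and> |A| <o \<omega>\<^sub>1 \<and> |B| <o \<cc>"
  then have cA: "countable A"
    by (simp add: countable_iff_ordLess_omega1)
  define h where "h s = HCSet (acset (insert s A))" for s
  have h: "z in\<^sub>H h s \<longleftrightarrow> z = s \<or> z \<in> A" for z s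
    using cA by (simp add: h_def)
  define U where "U = (\<Union>b\<in>B. {z. z in\<^sub>H b})"
  have U: "|U| <o \<cc>"
    using AB unfolding U_def by (intro UN_countable_ordLess_continuum hcset_countable_elems) auto
  \<comment> \<open>On the complement of \<open>A\<close> the map \<open>h\<close> is injective,
    since \<open>s\<close> can be recovered from \<open>h s\<close>; hence \<open>bad\<close> is no
    larger than \<open>U\<close>.\<close>
  define bad where "bad = {s. s \<notin> A \<and> h s \<in> U}"
  have "inj_on h bad"
  proof (rule inj_onI)
    fix s t
    assume "s \<in> bad" "h s = h t"
    then show "s = t"
      using h[of s s] h[of s t] by (simp add: bad_def)
  qed
  then have "|bad| \<le>o |U|"
    by (rule card_of_ordLeqI) (simp add: bad_def)
  then have "|bad| <o \<cc>"
    using U by (rule ordLeq_ordLess_trans)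
  then have "|A \<union> B \<union> bad| <o \<cc>"
    using AB countable_ordLess_continuum[OF cA] by (intro Un_ordLess_continuum) auto
  then have "A \<union> B \<union> bad \<noteq> UNIV"
    using continuum_le_card_hcset not_ordLess_ordLeq by fastforce
  then obtain s where "s \<notin> A" "s \<notin> B" "h s \<notin> U"
    by (auto simp: bad_def)
  \<comment> \<open>No \<open>b\<close> in \<open>B\<close> lies in \<open>h s\<close>, as
    \<open>s\<close> is not in \<open>B\<close> and \<open>A\<close> misses \<open>B\<close>;
    \<open>h s\<close> lies in no such \<open>b\<close>, as it is outside \<open>U\<close>.\<close>
  then show "\<exists>v\<in>UNIV. A \<subseteq> neighbours hedge v \<and> B \<inter> neighbours hedge v = {}"
    using AB by (intro bexI[of _ "h s"]) (auto simp: neighbours_def hedge_def h U_def)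
qed

section \<open>Embedding into saturated graphs\<close>

lemma saturated_graph_witness:
  assumes "saturated_graph \<omega>\<^sub>1 \<cc> W F"
    and "A \<subseteq> W" "B \<subseteq> W" "A \<inter> B = {}" "countable A" "|B| <o \<cc>"
  shows "\<exists>v\<in>W. (\<forall>a\<in>A. F v a) \<and> (\<forall>b\<in>B. \<not> F v b)"
proof -
  have "\<exists>v\<in>W. A \<subseteq> neighbours F v \<and> B \<inter> neighbours F v = {}"
    using assms by (simp add: saturated_graph_def countable_iff_ordLess_omega1)
  then show ?thesis
    by (auto simp: neighbours_def)
qed

text \<open>
  Saturation alone does not keep the witness out of \<open>B\<close>.  A vertex \<open>u\<close> not connected to \<open>B\<close> that also
  avoids, for each \<open>b \<in> B\<close>, some neighbour of \<open>b\<close> cannot lie in \<open>B\<close>, and a witness connected to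
  such a \<open>u\<close> cannot lie in \<open>B\<close> either.
\<close>

lemma saturated_graph_fresh_witness:
  assumes sat: "saturated_graph \<omega>\<^sub>1 \<cc> W F"
    and A: "A \<subseteq> W" "countable A" and B: "B \<subseteq> W" "|B| <o \<cc>" and disj: "A \<inter> B = {}"
  obtains v where "v \<in> W" "v \<notin> A \<union> B" "\<And>a. a \<in> A \<Longrightarrow> F v a" "\<And>b. b \<in> B \<Longrightarrow> \<not> F v b"
proof -
  interpret simple_graph W F
    using sat by (simp add: saturated_graph_def)
  have "\<exists>w\<in>W. F w b" if "b \<in> W" for b
    using saturated_graph_witness[OF sat, of "{b}" "{}"] that countable_ordLess_continuum[of "{}"]
    by simp
  then obtain n where n: "\<And>b. b \<in> W \<Longrightarrow> n b \<in> W \<and> F (n b) b"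
    by metis
  have "|B \<union> n ` B| <o \<cc>"
    by (intro Un_ordLess_continuum image_ordLess B)
  moreover have "B \<union> n ` B \<subseteq> W"
    using B(1) n by auto
  ultimately obtain u where u: "u \<in> W" "\<And>b. b \<in> B \<union> n ` B \<Longrightarrow> \<not> F u b"
    using saturated_graph_witness[OF sat, of "{}" "B \<union> n ` B"] by auto
  have uB: "u \<notin> B"
  proof
    assume "u \<in> B"
    then have "\<not> F u (n u)"
      using u(2) by simp
    then show False
      using n[OF u(1)] edge_sym[of "n u" u] by simp
  qed
  have "\<exists>v\<in>W. (\<forall>a\<in>insert u A. F v a) \<and> (\<forall>b\<in>B. \<not> F v b)"
    using A B disj uB u(1) by (intro saturated_graph_witness[OF sat]) auto
  then obtain v where v: "v \<in> W" "\<And>a. a \<in> insert u A \<Longrightarrow> F v a" "\<And>b. b \<in> B \<Longrightarrow> \<not> F v b"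
    by blast
  have "v \<notin> A"
    using v(2) edge_irrefl by auto
  moreover have "v \<notin> B"
    using v(2)[of u] u(2) edge_sym[of v u] by auto
  ultimately show thesis
    using v by (intro that[of v]) auto
qed

lemma embedding_into_saturated_graph:
  fixes E :: "'a \<Rightarrow> 'a \<Rightarrow> bool"
  assumes graph: "simple_graph UNIV E" and sat: "saturated_graph \<omega>\<^sub>1 \<cc> W F"
    and wf: "wf r" and total: "total r"
    and preds: "\<And>x. |{y. (y, x) \<in> r}| <o \<cc>"
    and nbrs: "\<And>x. countable {y. (y, x) \<in> r \<and> E x y}"
  shows "\<exists>f. induced_embedding f UNIV E W F"
proof -
  interpret E: simple_graph UNIV E by (fact graph)
  interpret F: simple_graph W F using sat by (simp add: saturated_graph_def)
  \<comment> \<open>The clause \<open>v \<noteq> f y\<close> secures injectivity; it is why a fresh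
    witness is required.\<close>
  define P where "P f x v \<longleftrightarrow> v \<in> W \<and> (\<forall>y. (y, x) \<in> r \<longrightarrow> v \<noteq> f y \<and> (F v (f y) \<longleftrightarrow> E x y))"
    for f x v
  have "\<exists>f. \<forall>x. P f x (f x)"
  proof (rule dependent_wf_choice[OF wf])
    show "P f x v = P g x v" if "\<And>z. (z, x) \<in> r \<Longrightarrow> f z = g z" for f g x v
      using that by (auto simp: P_def)
  next
    fix x f
    assume IH: "\<And>y. (y, x) \<in> r \<Longrightarrow> P f y (f y)"
    define A where "A = f ` {y. (y, x) \<in> r \<and> E x y}"
    define B where "B = f ` {y. (y, x) \<in> r \<and> \<not> E x y}"
    \<comment> \<open>Of two distinct predecessors of \<open>x\<close>, the later one was given a
      value different from that of the earlier one.\<close>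
    have inj: "y = z" if "(y, x) \<in> r" "(z, x) \<in> r" "f y = f z" for y z
      using that IH total unfolding P_def total_on_def by (metis UNIV_I)
    have "A \<subseteq> W" "B \<subseteq> W"
      using IH by (auto simp: A_def B_def P_def)
    moreover have "A \<inter> B = {}"
      using inj by (auto simp: A_def B_def)
    moreover have "countable A"
      using nbrs by (simp add: A_def)
    moreover have "|B| <o \<cc>"
      unfolding B_def by (rule image_ordLess, rule subset_ordLess[OF _ preds[of x]]) auto
    ultimately obtain v where "v \<in> W" "v \<notin> A \<union> B"
        "\<And>a. a \<in> A \<Longrightarrow> F v a" "\<And>b. b \<in> B \<Longrightarrow> \<not> F v b"
      using saturated_graph_fresh_witness[OF sat] by metis
    then have "P f x v"
      by (auto simp: P_def A_def B_def)
    then show "\<exists>v. P f x v" ..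
  qed
  then obtain f where f: "\<And>x. P f x (f x)" by blast
  have pair: "f x \<noteq> f y \<and> (F (f x) (f y) \<longleftrightarrow> E x y)" if "x \<noteq> y" for x y
    using that total f E.edge_sym F.edge_sym unfolding P_def total_on_def by (metis UNIV_I)
  moreover have "F (f x) (f y) \<longleftrightarrow> E x y" for x y
    using pair E.edge_irrefl F.edge_irrefl by metis
  ultimately have "induced_embedding f UNIV E W F"
    using f by (auto simp: induced_embedding_def inj_on_def P_def)
  then show ?thesis
    by blast
qed

section \<open>An enumeration of the hereditarily countable sets\<close>

text \<open>Recursion along membership: a set has countably many elements, so their ranks have a
  strict bound in \<open>\<omega>\<^sub>1\<close>.\<close>

lemma hmem_rank: "\<exists>rank. \<forall>x y. y in\<^sub>H x \<longrightarrow> (rank y, rank x) \<in> \<omega>\<^sub>1 - Id"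
proof -
  define P where "P f x r \<longleftrightarrow> r \<in> Field \<omega>\<^sub>1 \<and> (\<forall>y. y in\<^sub>H x \<longrightarrow> (f y, r) \<in> \<omega>\<^sub>1 - Id)" for f x r
  have "\<exists>f. \<forall>x. P f x (f x)"
  proof (rule dependent_wf_choice)
    show "wf {(x, y). x in\<^sub>H y}"
      using wfp_hmem by (simp add: wfp_def)
  next
    show "P f x v = P g x v" if "\<And>z. (z, x) \<in> {(x, y). x in\<^sub>H y} \<Longrightarrow> f z = g z" for f g x v
      using that by (auto simp: P_def)
  next
    fix x f
    assume "\<And>y. (y, x) \<in> {(x, y). x in\<^sub>H y} \<Longrightarrow> P f y (f y)"
    then have "f ` {y. y in\<^sub>H x} \<subseteq> Field \<omega>\<^sub>1"
      by (auto simp: P_def)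
    then show "\<exists>r. P f x r"
      using omega1_countable_strict_bound[of "f ` {y. y in\<^sub>H x}"] hcset_countable_elems[of x]
      by (auto simp: P_def)
  qed
  then show ?thesis
    by (auto simp: P_def)
qed

text \<open>
  Along the well-order \<open>|UNIV|\<close>, whose initial segments are smaller than the continuum, let \<open>\<rho> x\<close> be
  the first set whose transitive closure contains \<open>x\<close>.  Then \<open>\<rho>\<close> has countable fibres and does not
  increase from a set to its elements; ties are broken first by rank, so that elements precede sets.
\<close>

lemma hcset_enumeration:
  "\<exists>r :: hcset rel. wf r \<and> total r \<and> (\<forall>x. |{y. (y, x) \<in> r}| <o \<cc>) \<and> (\<forall>x y. y in\<^sub>H x \<longrightarrow> (y, x) \<in> r)"
proof -
  define s where "s = |UNIV :: hcset set|"
  have card: "Card_order s" and field: "Field s = UNIV"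
    unfolding s_def by (rule card_of_Card_order, rule Field_card_of)
  have wo: "wo_rel s"
    using card by (simp add: wo_rel_def card_order_on_def)
  have wf_s: "wf (s - Id)"
    using wo by (rule wo_rel.WF)
  have s_cases: "a = b \<or> (a, b) \<in> s - Id \<or> (b, a) \<in> s - Id" for a b
    using wo_rel.TOTAL[OF wo] by (auto simp: total_on_def field)
  have wo': "wo_rel \<omega>\<^sub>1"
    using cardSuc_Card_order[OF natLeq_Card_order] by (simp add: wo_rel_def card_order_on_def)
  obtain rank where rank: "\<And>x y. y in\<^sub>H x \<Longrightarrow> (rank y, rank x) \<in> \<omega>\<^sub>1 - Id"
    using hmem_rank by blast
  have "\<exists>a. x \<in> htrcl a \<and> (\<forall>b. x \<in> htrcl b \<longrightarrow> (b, a) \<notin> s - Id)" for x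
    using wfE_min[OF wf_s, of x "{a. x \<in> htrcl a}"] htrcl_refl[of x] by (metis mem_Collect_eq)
  then obtain \<rho> where \<rho>: "\<And>x. x \<in> htrcl (\<rho> x)"
      and \<rho>_least: "\<And>x b. x \<in> htrcl b \<Longrightarrow> (b, \<rho> x) \<notin> s - Id"
    by metis
  \<comment> \<open>The last coordinate separates distinct sets that agree in both
    \<open>\<rho>\<close> and \<open>rank\<close>.\<close>
  define r where "r = inv_image ((s - Id) <*lex*> (\<omega>\<^sub>1 - Id) <*lex*> (s - Id)) (\<lambda>x. (\<rho> x, rank x, x))"
  have "wf r"
    unfolding r_def using wf_s wo_rel.WF[OF wo'] by (intro wf_inv_image wf_lex_prod)
  moreover have "total r"
    unfolding total_on_def
  proof (intro ballI impI)
    fix x y :: hcset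
    assume "x \<noteq> y"
    \<comment> \<open>Every set is an element of its singleton, so its rank lies below another
      one.\<close>
    have "rank z \<in> Field \<omega>\<^sub>1" for z
      using rank[of z "HCSet (acset {z})"] by (auto simp: Field_def)
    then have "rank x = rank y \<or> (rank x, rank y) \<in> \<omega>\<^sub>1 - Id \<or> (rank y, rank x) \<in> \<omega>\<^sub>1 - Id"
      using wo_rel.TOTAL[OF wo'] by (auto simp: total_on_def)
    then show "(x, y) \<in> r \<or> (y, x) \<in> r"
      using s_cases[of "\<rho> x" "\<rho> y"] s_cases[of x y] \<open>x \<noteq> y\<close>
      unfolding r_def in_inv_image in_lex_prod by argo
  qed
  moreover have "|{y. (y, x) \<in> r}| <o \<cc>" for x
  proof -
    have "|underS s (\<rho> x)| <o \<cc>"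
      using card_hcset_le_continuum card_of_underS[OF card, of "\<rho> x"] field
      by (auto simp: s_def intro: ordLess_ordLeq_trans)
    then have "|underS s (\<rho> x) \<union> {\<rho> x}| <o \<cc>"
      by (rule Un_ordLess_continuum) (simp add: countable_ordLess_continuum)
    then have "|\<Union>a \<in> underS s (\<rho> x) \<union> {\<rho> x}. htrcl a| <o \<cc>"
      by (rule UN_countable_ordLess_continuum) (rule countable_htrcl)
    \<comment> \<open>A predecessor \<open>y\<close> has \<open>\<rho> y\<close> at or before
      \<open>\<rho> x\<close> and lies in the countable set \<open>htrcl (\<rho> y)\<close>.\<close>
    moreover have "{y. (y, x) \<in> r} \<subseteq> (\<Union>a \<in> underS s (\<rho> x) \<union> {\<rho> x}. htrcl a)"
    proof
      fix y
      assume "y \<in> {y. (y, x) \<in> r}"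
      then have "\<rho> y \<in> underS s (\<rho> x) \<union> {\<rho> x}"
        unfolding mem_Collect_eq r_def in_inv_image in_lex_prod by (auto simp: underS_def)
      then show "y \<in> (\<Union>a \<in> underS s (\<rho> x) \<union> {\<rho> x}. htrcl a)"
        using \<rho> by blast
    qed
    ultimately show ?thesis
      by (rule subset_ordLess[rotated])
  qed
  moreover have "(y, x) \<in> r" if "y in\<^sub>H x" for x y
  proof -
    have "(\<rho> x, \<rho> y) \<notin> s - Id"
      by (rule \<rho>_least[OF htrcl_hmem[OF that \<rho>]])
    then have "\<rho> y = \<rho> x \<or> (\<rho> y, \<rho> x) \<in> s - Id"
      using s_cases[of "\<rho> x" "\<rho> y"] by argo
    then show ?thesis
      using rank[OF that] unfolding r_def in_inv_image in_lex_prod by argo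
  qed
  ultimately show ?thesis
    by blast
qed

theorem theorem18:
  "prime_saturated_graph TYPE('b) \<omega>\<^sub>1 \<cc> (UNIV :: hcset set) hedge"
  unfolding prime_saturated_graph_def
proof (intro conjI allI impI saturated_hedge)
  fix W :: "'b set" and F
  assume sat: "saturated_graph \<omega>\<^sub>1 \<cc> W F"
  obtain r :: "hcset rel" where r: "wf r" "total r" "\<And>x. |{y. (y, x) \<in> r}| <o \<cc>"
      "\<And>x y. y in\<^sub>H x \<Longrightarrow> (y, x) \<in> r"
    using hcset_enumeration by blast
  show "\<exists>f. induced_embedding f UNIV hedge W F"
  proof (rule embedding_into_saturated_graph[OF simple_graph_hedge sat r(1,2,3)])
    fix x
    \<comment> \<open>If instead \<open>x\<close> were an element of \<open>y\<close>, then
      \<open>x\<close> would precede \<open>y\<close>, contradicting asymmetry of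
      \<open>r\<close>.\<close>
    have "{y. (y, x) \<in> r \<and> hedge x y} \<subseteq> {y. y in\<^sub>H x}"
      using r(1,4) by (auto simp: hedge_def dest: wf_not_sym)
    then show "countable {y. (y, x) \<in> r \<and> hedge x y}"
      using hcset_countable_elems by (rule countable_subset)
  qed
qed

end
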